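(* Let $G$ be a connected unicyclic graph (a connected graph with exactly one cycle) of order $n\geq 3$ and maximum degree $\Delta(G)$, and let $k$ be an integer with $3\leq k\leq n$. If $G$ satisfies all of the following: (i) $G$ has at most two vertices of degree $\Delta(G)$; (ii) every vertex of degree $\Delta(G)$ lies on the unique cycle of $G$; (iii) if there are two vertices of degree $\Delta(G)$, they are adjacent in $G$; then $px_k(G)=\Delta(G)-1$. Otherwise, $px_k(G)=\Delta(G)$.
   Context: All graphs are finite, simple, undirected and connected. An edge-coloring of a graph assigns a color to each edge (adjacent edges may receive the same color). A tree in an edge-colored graph is proper if any two adjacent edges of the tree receive different colors. For $S\subseteq V(G)$, an $S$-tree is a subgraph of $G$ that is a tree containing all vertices of $S$. For a connected graph $G$ of order $n$ and an integer $k$ with $2\le k\le n$, an edge-coloring of $G$ is a $k$-proper coloring if for every set $S$ of $k$ vertices of $G$ there exists a proper $S$-tree in $G$. The $k$-proper index $px_k(G)$ is the minimum number of colors used in a $k$-proper coloring of $G$. *)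

theory Defs
  imports Main
begin

text \<open>Simple graphs: a vertex set V and an edge set E of 2-element subsets of V.\<close>

definition simple_graph :: "'a set \<Rightarrow> 'a set set \<Rightarrow> bool" where
  "simple_graph V E \<longleftrightarrow> finite V \<and> (\<forall>e\<in>E. \<exists>u v. u \<in> V \<and> v \<in> V \<and> u \<noteq> v \<and> e = {u, v})"

definition adj_rel :: "'a set set \<Rightarrow> ('a \<times> 'a) set" where
  "adj_rel E = {(u, v). {u, v} \<in> E}"

definition connected_graph :: "'a set \<Rightarrow> 'a set set \<Rightarrow> bool" where
  "connected_graph V E \<longleftrightarrow> V \<noteq> {} \<and> (\<forall>u\<in>V. \<forall>v\<in>V. (u, v) \<in> (adj_rel E)\<^sup>*)"

definition degree :: "'a set set \<Rightarrow> 'a \<Rightarrow> nat" where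
  "degree E v = card {e \<in> E. v \<in> e}"

definition max_degree :: "'a set \<Rightarrow> 'a set set \<Rightarrow> nat" where
  "max_degree V E = Max (degree E ` V)"

text \<open>A cycle (as an edge set): a nonempty connected 2-regular subgraph.\<close>
definition is_cycle_in :: "'a set set \<Rightarrow> 'a set set \<Rightarrow> bool" where
  "is_cycle_in E C \<longleftrightarrow> C \<noteq> {} \<and> C \<subseteq> E \<and> connected_graph (\<Union>C) C
     \<and> (\<forall>v\<in>\<Union>C. degree C v = 2)"

definition unicyclic :: "'a set \<Rightarrow> 'a set set \<Rightarrow> bool" where
  "unicyclic V E \<longleftrightarrow> connected_graph V E \<and> (\<exists>!C. is_cycle_in E C)"

text \<open>A subgraph (VT, ET) of (V, E) that is a tree (connected, acyclic).\<close>
definition is_subtree :: "'a set \<Rightarrow> 'a set set \<Rightarrow> 'a set \<Rightarrow> 'a set set \<Rightarrow> bool" where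
  "is_subtree V E VT ET \<longleftrightarrow> VT \<subseteq> V \<and> ET \<subseteq> E \<and> (\<forall>e\<in>ET. e \<subseteq> VT)
     \<and> connected_graph VT ET \<and> \<not> (\<exists>C. is_cycle_in ET C)"

text \<open>A tree is proper under colouring c if adjacent tree edges get different colours.\<close>
definition proper_tree :: "('a set \<Rightarrow> nat) \<Rightarrow> 'a set set \<Rightarrow> bool" where
  "proper_tree c ET \<longleftrightarrow> (\<forall>e\<in>ET. \<forall>f\<in>ET. e \<noteq> f \<and> e \<inter> f \<noteq> {} \<longrightarrow> c e \<noteq> c f)"

definition k_proper_coloring :: "'a set \<Rightarrow> 'a set set \<Rightarrow> nat \<Rightarrow> ('a set \<Rightarrow> nat) \<Rightarrow> bool" where
  "k_proper_coloring V E k c \<longleftrightarrow>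
     (\<forall>S. S \<subseteq> V \<and> card S = k \<longrightarrow>
        (\<exists>VT ET. is_subtree V E VT ET \<and> S \<subseteq> VT \<and> proper_tree c ET))"

text \<open>The k-proper index: minimum number of colours used by a k-proper colouring.\<close>
definition proper_index :: "'a set \<Rightarrow> 'a set set \<Rightarrow> nat \<Rightarrow> nat" where
  "proper_index V E k = (LEAST m. \<exists>c. k_proper_coloring V E k c \<and> card (c ` E) = m)"

end

theory Submission
  imports Defs
begin

text \<open>
  Upper bound: deleting a cycle edge \<open>e\<close> leaves a spanning tree, and a tree is properly
  edge-colourable with as many colours as its maximum degree. The three conditions say exactly
  that some cycle edge meets all vertices of degree \<open>\<Delta>\<close>, so that deleting it lowers the maximum
  degree.

  Lower bound: any three vertices lie in a proper tree. With fewer than \<open>\<Delta>\<close> colours, two edges of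
  equal colour (a clash) meet at each vertex of degree \<open>\<Delta>\<close>. Two clashing bridges cannot both be
  avoided by a tree joining their far ends, so a clash involves a cycle edge. Choosing three vertices
  around one clash forces a proper tree to omit one particular cycle edge and to contain all others;
  the clash at any vertex not on that edge would then lie inside the tree.
\<close>

section \<open>Paths and cycles\<close>

lemma adj_rel_rtrancl_mono: "(x, y) \<in> (adj_rel A)\<^sup>* \<Longrightarrow> A \<subseteq> B \<Longrightarrow> (x, y) \<in> (adj_rel B)\<^sup>*"
  by (rule subsetD[OF rtrancl_mono]) (auto simp: adj_rel_def)

lemma adj_rel_rtrancl_sym: "(x, y) \<in> (adj_rel A)\<^sup>* \<Longrightarrow> (y, x) \<in> (adj_rel A)\<^sup>*"
proof -
  have "sym (adj_rel A)" by (auto simp: sym_def adj_rel_def insert_commute)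
  then show "(x, y) \<in> (adj_rel A)\<^sup>* \<Longrightarrow> (y, x) \<in> (adj_rel A)\<^sup>*"
    by (meson sym_rtrancl symD)
qed

lemma adj_rel_edge: "{x, y} \<in> A \<Longrightarrow> (x, y) \<in> (adj_rel A)\<^sup>*"
  by (auto simp: adj_rel_def)

lemma degree_insert:
  "finite F \<Longrightarrow> e \<notin> F \<Longrightarrow> degree (insert e F) x = degree F x + (if x \<in> e then 1 else 0)"
proof -
  assume *: "finite F" "e \<notin> F"
  have "{f \<in> insert e F. x \<in> f} = (if x \<in> e then insert e {f \<in> F. x \<in> f} else {f \<in> F. x \<in> f})"
    by auto
  then show ?thesis using * by (simp add: degree_def)
qed

lemma degree_mono: "finite B \<Longrightarrow> A \<subseteq> B \<Longrightarrow> degree A x \<le> degree B x"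
  unfolding degree_def by (rule card_mono) auto

lemma degree_eq_0: "x \<notin> \<Union>F \<Longrightarrow> degree F x = 0"
  unfolding degree_def by (metis (mono_tags, lifting) UnionI card.empty empty_Collect_eq)

text \<open>A simple path is kept as its edge set alone and grows at the far end by a fresh vertex.
  Empty paths are excluded, so both ends lie in \<open>\<Union>P\<close> and have degree 1.\<close>

inductive path_edges :: "'a \<Rightarrow> 'a set set \<Rightarrow> 'a \<Rightarrow> bool" for u where
  single: "u \<noteq> v \<Longrightarrow> path_edges u {{u, v}} v"
| extend: "path_edges u P y \<Longrightarrow> z \<notin> \<Union>P \<Longrightarrow> path_edges u (insert {y, z} P) z"

lemma path_edges_ends:
  assumes "path_edges u P v"
  shows "finite P" "u \<in> \<Union>P" "v \<in> \<Union>P" "u \<noteq> v"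
  using assms by (induction) auto

lemma path_edges_degree:
  assumes "path_edges u P v"
  shows "degree P u = 1 \<and> degree P v = 1 \<and> (\<forall>w\<in>\<Union>P. w \<noteq> u \<longrightarrow> w \<noteq> v \<longrightarrow> degree P w = 2)"
  using assms
proof induction
  case (single v)
  have "{e \<in> {{u, v}}. x \<in> e} = {{u, v}}" if "x = u \<or> x = v" for x using that by auto
  then show ?case by (auto simp: degree_def)
next
  case (extend P y z)
  note e = path_edges_ends[OF extend.hyps(1)]
  have "{y, z} \<notin> P" using extend.hyps(2) by auto
  then have d: "degree (insert {y, z} P) x = degree P x + (if x \<in> {y, z} then 1 else 0)" for x
    using degree_insert e(1) by metis
  have "y \<noteq> z" "u \<noteq> z" using extend.hyps(2) e by auto
  moreover have "degree P z = 0" using extend.hyps(2) by (rule degree_eq_0)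
  ultimately show ?case using extend.IH e(4) unfolding d by auto
qed

lemma path_edges_reach:
  assumes "path_edges u P v"
  shows "w \<in> \<Union>P \<Longrightarrow> (u, w) \<in> (adj_rel P)\<^sup>*"
  using assms
proof (induction arbitrary: w)
  case (single v)
  then show ?case by (auto simp: adj_rel_def)
next
  case (extend P y z)
  have r: "(u, x) \<in> (adj_rel (insert {y, z} P))\<^sup>*" if "x \<in> \<Union>P" for x
    using extend.IH[OF that] by (rule adj_rel_rtrancl_mono) auto
  have "y \<in> \<Union>P" using path_edges_ends[OF extend.hyps(1)] by simp
  then have "(u, z) \<in> (adj_rel (insert {y, z} P))\<^sup>*"
    by (meson r adj_rel_edge insertI1 rtrancl_trans)
  moreover have "w \<in> \<Union>P \<or> w = z" using extend.prems \<open>y \<in> \<Union>P\<close> by auto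
  ultimately show ?case using r by blast
qed

lemma path_edges_subpath:
  assumes "path_edges u P v" "w \<in> \<Union>P" "w \<noteq> u"
  shows "\<exists>Q\<subseteq>P. path_edges u Q w"
  using assms
proof (induction arbitrary: w)
  case (single v)
  then have "w = v" by auto
  then show ?case using path_edges.single[OF single.hyps] by blast
next
  case (extend P y z)
  have "y \<in> \<Union>P" using path_edges_ends[OF extend.hyps(1)] by simp
  then consider "w \<in> \<Union>P" | "w = z" using extend.prems by auto
  then show ?case
  proof cases
    case 1
    then show ?thesis using extend.IH[OF 1 extend.prems(2)] by blast
  next
    case 2
    then show ?thesis using path_edges.extend[OF extend.hyps] by blast
  qed
qed

lemma path_edges_exists:
  assumes "(u, v) \<in> (adj_rel F)\<^sup>*" "u \<noteq> v"
  shows "\<exists>P\<subseteq>F. path_edges u P v"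
  using assms
proof induction
  case base
  then show ?case by simp
next
  case (step y z)
  have yz: "{y, z} \<in> F" using step.hyps(2) by (simp add: adj_rel_def)
  show ?case
  proof (cases "u = y")
    case True
    then show ?thesis using yz path_edges.single[OF step.prems] by blast
  next
    case False
    then obtain P where P: "P \<subseteq> F" "path_edges u P y" using step.IH by blast
    show ?thesis
    proof (cases "z \<in> \<Union>P")
      case True
      \<comment> \<open>The walk returns to a vertex already on \<open>P\<close>, so the loop is cut
        off by taking an initial segment of \<open>P\<close>.\<close>
      then show ?thesis using path_edges_subpath[OF P(2) True] step.prems P(1) by blast
    next
      case False
      then show ?thesis using path_edges.extend[OF P(2) False] P(1) yz
        by (intro exI[of _ "insert {y, z} P"]) auto
    qed
  qed
qed

text \<open>Closing a path from \<open>u\<close> to \<open>v\<close> with the new edge raises both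
  ends from degree 1 to 2, while inner vertices already have degree 2.\<close>

lemma cycle_through_edge:
  assumes "(u, v) \<in> (adj_rel F)\<^sup>*" "u \<noteq> v" "{u, v} \<notin> F"
  shows "\<exists>C. is_cycle_in (insert {u, v} F) C \<and> {u, v} \<in> C"
proof -
  obtain P where P: "P \<subseteq> F" "path_edges u P v" using path_edges_exists assms by metis
  note ends = path_edges_ends[OF P(2)] and deg = path_edges_degree[OF P(2)]
  let ?C = "insert {u, v} P"
  have "{u, v} \<notin> P" using P(1) assms(3) by auto
  then have d: "degree ?C x = degree P x + (if x \<in> {u, v} then 1 else 0)" for x
    using degree_insert ends(1) by metis
  have U: "\<Union>?C = \<Union>P" using ends by auto
  have r: "(u, w) \<in> (adj_rel ?C)\<^sup>*" if "w \<in> \<Union>P" for w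
    using path_edges_reach[OF P(2) that] by (rule adj_rel_rtrancl_mono) auto
  have "connected_graph (\<Union>?C) ?C"
    unfolding connected_graph_def U
    using r ends(2) by (blast intro: rtrancl_trans adj_rel_rtrancl_sym)
  moreover have "\<forall>w\<in>\<Union>?C. degree ?C w = 2"
    unfolding U d using deg by auto
  ultimately have "is_cycle_in (insert {u, v} F) ?C"
    unfolding is_cycle_in_def using P(1) by auto
  then show ?thesis by blast
qed

text \<open>If \<open>v\<close> were out of reach, every path from \<open>u\<close> avoiding the
  edge could be prolonged: its last vertex has a further edge in \<open>C\<close>, and running back
  into the path would create degree 3. Arbitrarily long paths contradict finiteness.\<close>

lemma cycle_minus_edge_reach:
  assumes fin: "finite C" and two: "\<And>e. e \<in> C \<Longrightarrow> \<exists>x y. x \<noteq> y \<and> e = {x, y}"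
    and deg: "\<And>w. w \<in> \<Union>C \<Longrightarrow> degree C w = 2" and uv: "{u, v} \<in> C"
  shows "(u, v) \<in> (adj_rel (C - {{u, v}}))\<^sup>*"
proof (rule ccontr)
  assume nr: "(u, v) \<notin> (adj_rel (C - {{u, v}}))\<^sup>*"
  let ?e = "{u, v}" and ?D = "C - {{u, v}}"
  have other: "\<exists>z. z \<noteq> w \<and> {w, z} \<in> C - A" if "w \<in> \<Union>C" "degree A w = 1" for w A
  proof -
    have "\<not> {f \<in> C. w \<in> f} \<subseteq> {f \<in> A. w \<in> f}"
    proof
      assume "{f \<in> C. w \<in> f} \<subseteq> {f \<in> A. w \<in> f}"
      then have "card {f \<in> C. w \<in> f} \<le> card {f \<in> A. w \<in> f}"
        using that(2) by (intro card_mono) (auto simp: degree_def intro: card_ge_0_finite)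
      then show False using deg[OF that(1)] that(2) by (simp add: degree_def)
    qed
    then obtain f where f: "f \<in> C" "w \<in> f" "f \<notin> A" by blast
    obtain x y where "x \<noteq> y" "f = {x, y}" using two[OF f(1)] by blast
    then show ?thesis using f by (cases "w = x") (auto simp: insert_commute)
  qed
  have "\<exists>Q y. path_edges u Q y \<and> Q \<subseteq> ?D \<and> n \<le> card Q" for n
  proof (induction n)
    case 0
    have "{f \<in> {?e}. u \<in> f} = {?e}" by auto
    then have "degree {?e} u = 1" by (simp add: degree_def)
    then obtain z where "z \<noteq> u" "{u, z} \<in> C - {?e}" using other uv by blast
    then show ?case using path_edges.single[of u z] by (intro exI[of _ "{{u, z}}"] exI[of _ z]) auto
  next
    case (Suc n)
    then obtain Q y where Q: "path_edges u Q y" "Q \<subseteq> ?D" "n \<le> card Q" by blast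
    note ends = path_edges_ends[OF Q(1)] and dQ = path_edges_degree[OF Q(1)]
    have "(u, y) \<in> (adj_rel ?D)\<^sup>*"
      using adj_rel_rtrancl_mono[OF path_edges_reach[OF Q(1) ends(3)] Q(2)] .
    then have yv: "y \<noteq> v" using nr by auto
    have "y \<in> \<Union>C" using ends(3) Q(2) by auto
    then obtain z where z: "z \<noteq> y" "{y, z} \<in> C - Q" using other[of y Q] dQ by metis
    have ne: "{y, z} \<noteq> ?e" using yv ends(4) by (auto simp: doubleton_eq_iff)
    have "z \<notin> \<Union>Q"
    proof
      assume zQ: "z \<in> \<Union>Q"
      have d1: "degree (insert {y, z} Q) x = degree Q x + (if x \<in> {y, z} then 1 else 0)" for x
        using degree_insert[OF ends(1)] z(2) by blast
      have zC: "degree C z = 2" using zQ Q(2) deg by blast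
      show False
      \<comment> \<open>At \<open>u\<close> the third edge is the removed \<open>?e\<close>; at an
        inner vertex of \<open>Q\<close>, the edge \<open>{y, z}\<close> joins two path
        edges.\<close>
      proof (cases "z = u")
        case True
        have "?e \<notin> insert {y, z} Q" using ne Q(2) by auto
        then have "degree (insert ?e (insert {y, z} Q)) u = 3"
          using degree_insert[of "insert {y, z} Q" ?e u] ends(1) d1 dQ True by simp
        moreover have "degree (insert ?e (insert {y, z} Q)) u \<le> degree C u"
          using z(2) uv Q(2) by (intro degree_mono[OF fin]) auto
        ultimately show False using zC True by simp
      next
        case False
        then have "degree Q z = 2" using dQ zQ z(1) by blast
        then have "degree (insert {y, z} Q) z = 3" using d1 by simp
        moreover have "degree (insert {y, z} Q) z \<le> degree C z"
          using z(2) Q(2) by (intro degree_mono[OF fin]) auto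
        ultimately show False using zC by simp
      qed
    qed
    then have "path_edges u (insert {y, z} Q) z" using path_edges.extend[OF Q(1)] by blast
    moreover have "insert {y, z} Q \<subseteq> ?D" using z(2) ne Q(2) by auto
    moreover have "Suc n \<le> card (insert {y, z} Q)" using z(2) ends(1) Q(3) by simp
    ultimately show ?case by blast
  qed
  then obtain Q y where "Q \<subseteq> ?D" "Suc (card C) \<le> card Q" by blast
  moreover have "card Q \<le> card C" using \<open>Q \<subseteq> ?D\<close> by (intro card_mono[OF fin]) auto
  ultimately show False by simp
qed

section \<open>Proper edge-colourings of forests\<close>

lemma free_colour:
  assumes "finite F" "degree F u < D"
  shows "\<exists>a<D. \<forall>f\<in>F. u \<in> f \<longrightarrow> c f \<noteq> (a::nat)"
proof (rule ccontr)
  assume "\<not> ?thesis"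
  then have "{..<D} \<subseteq> c ` {f \<in> F. u \<in> f}" by fastforce
  then have "card {..<D} \<le> card (c ` {f \<in> F. u \<in> f})" using assms(1) by (intro card_mono) auto
  also have "\<dots> \<le> degree F u" unfolding degree_def using assms(1) by (intro card_image_le) auto
  finally show False using assms(2) by simp
qed

text \<open>
  Adding the edge \<open>{u, v}\<close>: a colour \<open>a\<close> is free at \<open>u\<close> and \<open>b\<close> is free at \<open>v\<close>. Exchanging
  \<open>a\<close> and \<open>b\<close> in the component of \<open>u\<close> makes \<open>b\<close> free at both ends.
\<close>

lemma forest_proper_coloring:
  assumes "finite F" "\<And>e. e \<in> F \<Longrightarrow> \<exists>x y. x \<noteq> y \<and> e = {x, y}"
    "\<And>x y. {x, y} \<in> F \<Longrightarrow> (x, y) \<notin> (adj_rel (F - {{x, y}}))\<^sup>*"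
    "\<And>x. degree F x \<le> D"
  shows "\<exists>c. c ` F \<subseteq> {..<D} \<and> proper_tree c F"
  using assms
proof (induction F rule: finite_induct)
  case empty
  then show ?case by (simp add: proper_tree_def)
next
  case (insert e F)
  obtain u v where uv: "u \<noteq> v" "e = {u, v}" using insert.prems(1) by blast
  have deg: "degree F x + (if x \<in> e then 1 else 0) \<le> D" for x
    using insert.prems(3)[of x] degree_insert[OF insert.hyps] by simp
  have "\<exists>c. c ` F \<subseteq> {..<D} \<and> proper_tree c F"
  proof (rule insert.IH)
    show "\<exists>x y. x \<noteq> y \<and> f = {x, y}" if "f \<in> F" for f using insert.prems(1) that by blast
    show "(x, y) \<notin> (adj_rel (F - {{x, y}}))\<^sup>*" if "{x, y} \<in> F" for x y
      using insert.prems(2)[of x y] that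
        adj_rel_rtrancl_mono[of x y "F - {{x, y}}" "insert e F - {{x, y}}"] by blast
    show "degree F x \<le> D" for x using deg[of x] by simp
  qed
  then obtain c where c: "c ` F \<subseteq> {..<D}" "proper_tree c F" by blast
  have "degree F u < D" "degree F v < D" using deg[of u] deg[of v] uv by auto
  then obtain a b where a: "a < D" "\<And>f. f \<in> F \<Longrightarrow> u \<in> f \<Longrightarrow> c f \<noteq> a"
    and b: "b < D" "\<And>f. f \<in> F \<Longrightarrow> v \<in> f \<Longrightarrow> c f \<noteq> b"
    using free_colour[OF insert.hyps(1)] by metis
  have nr: "(u, v) \<notin> (adj_rel F)\<^sup>*"
    using insert.prems(2)[of u v] uv insert.hyps(2) by simp
  define K where "K = {f \<in> F. \<exists>x\<in>f. (u, x) \<in> (adj_rel F)\<^sup>*}"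
  define s where "s i = (if i = a then b else if i = b then a else i)" for i
  define c' where "c' f = (if f = e then b else if f \<in> K then s (c f) else c f)" for f
  have K: "(u, x) \<in> (adj_rel F)\<^sup>*" if fK: "f \<in> K" and xf: "x \<in> f" for f x
  proof -
    obtain y where y: "f \<in> F" "y \<in> f" "(u, y) \<in> (adj_rel F)\<^sup>*" using fK unfolding K_def by blast
    obtain p q where "f = {p, q}" using insert.prems(1) y(1) by blast
    then have "x = y \<or> f = {y, x}" using xf y(2) by auto
    then show ?thesis using y adj_rel_edge by (metis rtrancl_trans)
  qed
  have sinj: "s i = s j \<longleftrightarrow> i = j" for i j by (auto simp: s_def)
  have eF: "c' e \<noteq> c' f" if fF: "f \<in> F" and ef: "e \<inter> f \<noteq> {}" for f
  proof -
    have "f \<noteq> e" using fF insert.hyps by auto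
    \<comment> \<open>Edges at \<open>u\<close> lie in \<open>K\<close> and avoid \<open>a\<close>,
      so after the exchange they avoid \<open>b\<close>. Edges at \<open>v\<close> lie outside
      \<open>K\<close> and avoid \<open>b\<close> from the start.\<close>
    consider "u \<in> f" | "v \<in> f" using ef uv(2) by auto
    then show ?thesis
    proof cases
      case 1
      then have "f \<in> K" using fF by (auto simp: K_def)
      then show ?thesis using a(2)[OF fF 1] \<open>f \<noteq> e\<close> by (auto simp: c'_def s_def)
    next
      case 2
      then have "f \<notin> K" using K nr by blast
      then show ?thesis using b(2)[OF fF 2] \<open>f \<noteq> e\<close> by (auto simp: c'_def)
    qed
  qed
  have FF: "c' f \<noteq> c' g" if "f \<in> F" "g \<in> F" "f \<noteq> g" "f \<inter> g \<noteq> {}" for f g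
  proof -
    have "f \<noteq> e" "g \<noteq> e" using that insert.hyps by auto
    \<comment> \<open>Adjacent edges share a component, so either both are recoloured by the
      injective \<open>s\<close> or neither is.\<close>
    moreover have "f \<in> K \<longleftrightarrow> g \<in> K"
      using that K unfolding K_def by blast
    moreover have "c f \<noteq> c g" using c(2) that by (auto simp: proper_tree_def)
    ultimately show ?thesis by (simp add: c'_def sinj)
  qed
  have "c' ` insert e F \<subseteq> {..<D}"
    using c(1) a(1) b(1) by (auto simp: c'_def s_def)
  moreover have "proper_tree c' (insert e F)"
    unfolding proper_tree_def using eF FF by (metis Int_commute insertE)
  ultimately show ?case by blast
qed

section \<open>Unicyclic graphs\<close>

locale unicyclic_graph =
  fixes V :: "'a set" and E C :: "'a set set"
  assumes simple: "simple_graph V E"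
    and conn: "connected_graph V E"
    and cyc: "is_cycle_in E C"
    and uniq: "\<And>C'. is_cycle_in E C' \<Longrightarrow> C' = C"
begin

lemma edgeE:
  assumes "e \<in> E"
  obtains u v where "u \<in> V" "v \<in> V" "u \<noteq> v" "e = {u, v}"
  using simple assms unfolding simple_graph_def by blast

lemma edge_at:
  assumes "e \<in> E" "v \<in> e"
  obtains w where "w \<in> V" "v \<in> V" "v \<noteq> w" "e = {v, w}"
  using assms by (elim edgeE) (auto simp: insert_commute)

lemma finite_V: "finite V" using simple by (simp add: simple_graph_def)

lemma finite_E: "finite E"
proof (rule finite_subset)
  show "E \<subseteq> Pow V" using edgeE by blast
qed (simp add: finite_V)

lemma cycle_subset: "C \<subseteq> E" using cyc by (simp add: is_cycle_in_def)

lemma degree_cycle: "v \<in> \<Union>C \<Longrightarrow> degree C v = 2" using cyc unfolding is_cycle_in_def by blast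

text \<open>If the ends stayed connected, the edge would close a cycle through itself, and by
  uniqueness that cycle is \<open>C\<close>.\<close>

lemma non_cycle_edge_bridge:
  assumes "{u, v} \<in> E" "{u, v} \<notin> C"
  shows "(u, v) \<notin> (adj_rel (E - {{u, v}}))\<^sup>*"
proof
  assume r: "(u, v) \<in> (adj_rel (E - {{u, v}}))\<^sup>*"
  have "u \<noteq> v" using assms(1) by (auto elim: edgeE)
  then obtain C' where "is_cycle_in (insert {u, v} (E - {{u, v}})) C'" "{u, v} \<in> C'"
    using cycle_through_edge[OF r] by blast
  moreover have "insert {u, v} (E - {{u, v}}) = E" using assms(1) by auto
  ultimately show False using uniq assms(2) by auto
qed

lemma minus_cycle_edge_acyclic:
  assumes "e \<in> C" "F \<subseteq> E - {e}"
  shows "\<not> is_cycle_in F C'"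
proof
  assume "is_cycle_in F C'"
  then have "is_cycle_in E C'" "e \<notin> C'" using assms(2) by (auto simp: is_cycle_in_def)
  then show False using uniq assms(1) by auto
qed

text \<open>\<open>E - {e}\<close> is acyclic, so each of its edges is a bridge in it. This is the
  forest hypothesis for the colouring, and it also shows that no subtree joining the ends of a cycle
  edge can miss that edge together with another edge of \<open>C\<close>.\<close>

lemma minus_cycle_edge_bridge:
  assumes "e \<in> C" "{p, q} \<in> E" "{p, q} \<noteq> e"
  shows "(p, q) \<notin> (adj_rel (E - {e} - {{p, q}}))\<^sup>*"
proof
  assume r: "(p, q) \<in> (adj_rel (E - {e} - {{p, q}}))\<^sup>*"
  have "p \<noteq> q" using assms(2) by (auto elim: edgeE)
  then obtain C' where "is_cycle_in (insert {p, q} (E - {e} - {{p, q}})) C'"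
    using cycle_through_edge[OF r] by blast
  moreover have "insert {p, q} (E - {e} - {{p, q}}) \<subseteq> E - {e}" using assms(2,3) by auto
  ultimately show False using minus_cycle_edge_acyclic[OF assms(1)] by metis
qed

lemma cycle_edge_reach:
  assumes "{u, v} \<in> C"
  shows "(u, v) \<in> (adj_rel (C - {{u, v}}))\<^sup>*"
proof (rule cycle_minus_edge_reach)
  show "finite C" using finite_subset[OF cycle_subset finite_E] .
  show "\<exists>x y. x \<noteq> y \<and> e = {x, y}" if "e \<in> C" for e using that cycle_subset edgeE by blast
qed (use degree_cycle assms in auto)

text \<open>The rest of the cycle is a detour around \<open>e\<close>.\<close>

lemma minus_cycle_edge_connected:
  assumes "e \<in> C"
  shows "connected_graph V (E - {e})"
proof -
  have "e \<in> E" using assms cycle_subset by auto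
  then obtain u v where uv: "e = {u, v}" by (elim edgeE)
  have r: "(u, v) \<in> (adj_rel (E - {e}))\<^sup>*"
    using cycle_edge_reach[of u v] assms uv cycle_subset
    by (auto elim!: adj_rel_rtrancl_mono)
  have "(x, y) \<in> (adj_rel (E - {e}))\<^sup>*" if "{x, y} \<in> E" for x y
  proof (cases "{x, y} = e")
    case True
    then show ?thesis using r adj_rel_rtrancl_sym uv by (metis doubleton_eq_iff)
  next
    case False
    then show ?thesis using that by (intro adj_rel_edge) auto
  qed
  then have "adj_rel E \<subseteq> (adj_rel (E - {e}))\<^sup>*" by (auto simp: adj_rel_def)
  then have "(adj_rel E)\<^sup>* \<subseteq> (adj_rel (E - {e}))\<^sup>*" using rtrancl_subset_rtrancl by blast
  then show ?thesis using conn unfolding connected_graph_def by blast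
qed

text \<open>The ends are already joined along \<open>C\<close>, so an edge outside \<open>C\<close>
  between them would not be a bridge. This puts the edge between two vertices of maximum degree on
  the cycle.\<close>

lemma chord_in_cycle:
  assumes "u \<in> \<Union>C" "v \<in> \<Union>C" "{u, v} \<in> E"
  shows "{u, v} \<in> C"
proof (rule ccontr)
  assume *: "{u, v} \<notin> C"
  have "(u, v) \<in> (adj_rel C)\<^sup>*"
    using cyc assms(1,2) unfolding is_cycle_in_def connected_graph_def by metis
  then have "(u, v) \<in> (adj_rel (E - {{u, v}}))\<^sup>*"
    by (rule adj_rel_rtrancl_mono) (use * cycle_subset in auto)
  then show False using non_cycle_edge_bridge[OF assms(3) *] by simp
qed

section \<open>Edges forced into a subtree\<close>

lemma subtree_reach:
  assumes "is_subtree V E VT ET" "x \<in> VT" "y \<in> VT" "ET \<subseteq> F"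
  shows "(x, y) \<in> (adj_rel F)\<^sup>*"
  using assms adj_rel_rtrancl_mono unfolding is_subtree_def connected_graph_def by metis

text \<open>The tree has vertices on both sides of the bridge: \<open>w\<close> on one,
  \<open>x\<close> on the side of \<open>v\<close>.\<close>

lemma subtree_contains_bridge:
  assumes T: "is_subtree V E VT ET" and f: "{v, w} \<in> E" "{v, w} \<notin> C"
    and "w \<in> VT" "x \<in> VT" "(x, v) \<in> (adj_rel (E - {{v, w}}))\<^sup>*"
  shows "{v, w} \<in> ET"
proof (rule ccontr)
  assume "{v, w} \<notin> ET"
  then have "ET \<subseteq> E - {{v, w}}" using T by (auto simp: is_subtree_def)
  then have "(w, x) \<in> (adj_rel (E - {{v, w}}))\<^sup>*" using subtree_reach T assms by metis
  then have "(w, v) \<in> (adj_rel (E - {{v, w}}))\<^sup>*" using assms(6) by (rule rtrancl_trans)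
  then show False using non_cycle_edge_bridge[OF f] adj_rel_rtrancl_sym by metis
qed

text \<open>A tree missing both \<open>f\<close> and \<open>{a, b}\<close> would still join
  \<open>a\<close> to \<open>b\<close>, although \<open>{a, b}\<close> is a bridge once
  \<open>f\<close> is deleted.\<close>

lemma subtree_contains_rest_of_cycle:
  assumes T: "is_subtree V E VT ET" and e: "{a, b} \<in> C" "{a, b} \<notin> ET"
    and "a \<in> VT" "b \<in> VT" and f: "f \<in> C" "f \<noteq> {a, b}"
  shows "f \<in> ET"
proof (rule ccontr)
  assume "f \<notin> ET"
  then have "ET \<subseteq> E - {f} - {{a, b}}" using T e by (auto simp: is_subtree_def)
  then have "(a, b) \<in> (adj_rel (E - {f} - {{a, b}}))\<^sup>*" using subtree_reach T assms by metis
  then show False using minus_cycle_edge_bridge[OF f(1)] e(1) f(2) cycle_subset by blast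
qed

text \<open>The spanning tree \<open>E - {e}\<close>, properly coloured, serves as the
  \<open>S\<close>-tree for every \<open>S\<close>, whatever \<open>k\<close> is.\<close>

lemma coloring_from_spanning_tree:
  assumes e: "e \<in> C" and deg: "\<And>v. degree (E - {e}) v \<le> D"
  shows "\<exists>c. k_proper_coloring V E k c \<and> card (c ` E) \<le> D"
proof -
  let ?T = "E - {e}"
  have "\<exists>c. c ` ?T \<subseteq> {..<D} \<and> proper_tree c ?T"
  proof (rule forest_proper_coloring)
    show "finite ?T" using finite_E by simp
    show "\<exists>x y. x \<noteq> y \<and> f = {x, y}" if "f \<in> ?T" for f using that edgeE by blast
    show "(x, y) \<notin> (adj_rel (?T - {{x, y}}))\<^sup>*" if "{x, y} \<in> ?T" for x y
      using minus_cycle_edge_bridge[OF e] that by blast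
  qed (rule deg)
  then obtain c where c: "c ` ?T \<subseteq> {..<D}" "proper_tree c ?T" by blast
  have eE: "e \<in> E" using e cycle_subset by auto
  \<comment> \<open>The deleted edge reuses the colour of some other edge \<open>f\<close> and so
    adds no colour. Such an \<open>f\<close> exists because an end of \<open>e\<close> has degree 2
    in \<open>C\<close>.\<close>
  obtain f where f: "f \<in> ?T"
  proof -
    obtain u where u: "u \<in> e" "u \<in> \<Union>C" using e eE edgeE by (metis UnionI insertI1)
    have "?T \<noteq> {}"
    proof
      assume "?T = {}"
      then have "{g \<in> C. u \<in> g} \<subseteq> {e}" using cycle_subset by auto
      then have "card {g \<in> C. u \<in> g} \<le> card {e}" by (intro card_mono) auto
      then show False using degree_cycle[OF u(2)] by (simp add: degree_def)
    qed
    then show ?thesis using that by blast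
  qed
  define c' where "c' = c(e := c f)"
  have "c' ` E \<subseteq> {..<D}" using c(1) f by (auto simp: c'_def)
  then have "card (c' ` E) \<le> card {..<D}" by (intro card_mono) auto
  then have 1: "card (c' ` E) \<le> D" by simp
  have "proper_tree c' ?T" using c(2) by (auto simp: proper_tree_def c'_def)
  moreover have "is_subtree V E V ?T"
    unfolding is_subtree_def
    using minus_cycle_edge_connected[OF e] minus_cycle_edge_acyclic[OF e] edgeE by blast
  ultimately have "k_proper_coloring V E k c'" unfolding k_proper_coloring_def by blast
  then show ?thesis using 1 by blast
qed

end

section \<open>Colour clashes\<close>

text \<open>Asking for at most three vertices, rather than exactly three, lets the chosen vertices
  coincide and removes \<open>k\<close> from the lower bound.\<close>

locale unicyclic_three_proper = unicyclic_graph V E C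
  for V :: "'a set" and E C :: "'a set set" +
  fixes c :: "'a set \<Rightarrow> nat"
  assumes three_proper: "\<And>S. S \<subseteq> V \<Longrightarrow> card S \<le> 3 \<Longrightarrow>
    \<exists>VT ET. is_subtree V E VT ET \<and> S \<subseteq> VT \<and> proper_tree c ET"
begin

definition clash :: "'a \<Rightarrow> 'a set \<Rightarrow> 'a set \<Rightarrow> bool" where
  "clash v g h \<longleftrightarrow> g \<in> E \<and> h \<in> E \<and> g \<noteq> h \<and> v \<in> g \<and> v \<in> h \<and> c g = c h"

lemma clash_sym: "clash v g h \<Longrightarrow> clash v h g" by (auto simp: clash_def)

lemma clash_not_in_proper: "clash v g h \<Longrightarrow> proper_tree c ET \<Longrightarrow> g \<in> ET \<Longrightarrow> h \<notin> ET"
  unfolding clash_def proper_tree_def by blast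

lemma three_proper':
  assumes "x \<in> V" "y \<in> V" "z \<in> V"
  obtains VT ET where "is_subtree V E VT ET" "x \<in> VT" "y \<in> VT" "z \<in> VT" "proper_tree c ET"
proof -
  have "card {x, y, z} \<le> 3" by (simp add: card_insert_if)
  then show ?thesis using three_proper[of "{x, y, z}"] assms that by auto
qed

lemma clash_pigeonhole:
  assumes "A \<subseteq> {e \<in> E. v \<in> e}" "card (c ` E) < card A"
  shows "\<exists>g\<in>A. \<exists>h\<in>A. clash v g h"
proof -
  have "card (c ` A) \<le> card (c ` E)" using assms(1) finite_E by (intro card_mono) auto
  then have "\<not> inj_on c A" using assms(2) card_image by fastforce
  then show ?thesis using assms(1) unfolding inj_on_def clash_def by blast
qed

text \<open>A tree through the far ends \<open>x\<close> and \<open>y\<close> of two clashing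
  bridges would contain both bridges.\<close>

lemma clash_meets_cycle:
  assumes "clash v g h"
  shows "g \<in> C \<or> h \<in> C"
proof (rule ccontr)
  assume n: "\<not> ?thesis"
  have gh: "g \<in> E" "h \<in> E" "g \<noteq> h" "v \<in> g" "v \<in> h" using assms by (auto simp: clash_def)
  obtain x where x: "x \<in> V" "g = {v, x}" using gh by (elim edge_at[of g v]) auto
  obtain y where y: "y \<in> V" "h = {v, y}" using gh by (elim edge_at[of h v]) auto
  obtain VT ET where T: "is_subtree V E VT ET" "x \<in> VT" "y \<in> VT" "proper_tree c ET"
    using three_proper'[OF x(1) y(1) y(1)] by blast
  have "(y, v) \<in> (adj_rel (E - {{v, x}}))\<^sup>*" "(x, v) \<in> (adj_rel (E - {{v, y}}))\<^sup>*"
    using gh x y by (auto intro!: adj_rel_edge simp: insert_commute)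
  then have "{v, x} \<in> ET" "{v, y} \<in> ET"
    using subtree_contains_bridge[OF T(1)] T(2,3) gh n x(2) y(2) by blast+
  then show False using clash_not_in_proper[OF assms T(4)] x y by simp
qed

text \<open>A proper tree through the far ends of \<open>g\<close> and \<open>h\<close> must use the
  bridge \<open>g\<close>, hence omits \<open>h\<close> and contains the rest of \<open>C\<close>. A
  third vertex then forces a clash away from \<open>h\<close> into the tree.\<close>

lemma mixed_clash_covers:
  assumes vgh: "clash v g h" "g \<notin> C" "h \<in> C" and uc: "clash u g' h'"
  shows "u \<in> h"
proof (rule ccontr)
  assume u: "u \<notin> h"
  have gh: "g \<in> E" "h \<in> E" "g \<noteq> h" "v \<in> g" "v \<in> h" using vgh by (auto simp: clash_def)
  obtain w where w: "w \<in> V" "g = {v, w}" using gh by (elim edge_at[of g v]) auto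
  obtain z where z: "z \<in> V" "h = {v, z}" using gh by (elim edge_at[of h v]) auto
  obtain p q where pq: "clash u p q" "q \<in> C"
    using uc clash_meets_cycle clash_sym by blast
  then have pE: "p \<in> E" "u \<in> p" "u \<in> q" "q \<in> E" "p \<noteq> q" by (auto simp: clash_def)
  \<comment> \<open>\<open>q\<close> is the edge of the second clash known to be on the cycle;
    \<open>p\<close> may be a bridge, and then \<open>t\<close> forces it into the tree.\<close>
  obtain t where t: "t \<in> V" "p = {u, t}" using pE by (elim edge_at[of p u]) auto
  obtain VT ET where T: "is_subtree V E VT ET" "w \<in> VT" "z \<in> VT" "t \<in> VT" "proper_tree c ET"
    using three_proper'[OF w(1) z(1) t(1)] by blast
  have sub: "e \<subseteq> VT" if "e \<in> ET" for e using T(1) that by (auto simp: is_subtree_def)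
  have "(z, v) \<in> (adj_rel (E - {{v, w}}))\<^sup>*"
    using gh w z by (auto intro!: adj_rel_edge simp: insert_commute)
  then have g: "g \<in> ET" using subtree_contains_bridge[OF T(1) _ _ T(2,3)] gh(1) vgh(2) w(2) by blast
  then have "v \<in> VT" using sub w by blast
  have "h \<notin> ET" using clash_not_in_proper[OF vgh(1) T(5) g] .
  then have rest: "f \<in> ET" if "f \<in> C" "u \<in> f" for f
    using subtree_contains_rest_of_cycle[OF T(1)] \<open>v \<in> VT\<close> T(3) vgh(3) z(2) that u by blast
  have q: "q \<in> ET" using rest pq(2) pE by blast
  then have "u \<in> VT" using sub pE by blast
  have "p \<in> ET"
  proof (cases "p \<in> C")
    case True
    then show ?thesis using rest pE by blast
  next
    case False
    then show ?thesis
      using subtree_contains_bridge[OF T(1) _ _ T(4) \<open>u \<in> VT\<close>] pE t(2) by blast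
  qed
  then show False using clash_not_in_proper[OF pq(1) T(5)] q by blast
qed

lemma cycle_edge_covers_clashes:
  assumes "clash v g h"
  shows "\<exists>e\<in>C. \<forall>u g' h'. clash u g' h' \<longrightarrow> u \<in> e"
\<comment> \<open>A mixed clash supplies its own cycle edge. Otherwise both edges of every clash lie
  on the cycle.\<close>
proof (cases "\<exists>v g h. clash v g h \<and> g \<notin> C \<and> h \<in> C")
  case True
  then show ?thesis using mixed_clash_covers by metis
next
  case False
  then have both: "p \<in> C \<and> q \<in> C" if "clash u p q" for u p q
    using clash_meets_cycle[OF that] clash_sym[OF that] that by blast
  have gh: "g \<in> E" "h \<in> E" "g \<noteq> h" "v \<in> g" "v \<in> h" using assms by (auto simp: clash_def)
  obtain x where x: "v \<in> V" "x \<in> V" "g = {v, x}" using gh by (elim edge_at[of g v]) auto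
  obtain y where y: "y \<in> V" "h = {v, y}" using gh by (elim edge_at[of h v]) auto
  obtain VT ET where T: "is_subtree V E VT ET" "v \<in> VT" "x \<in> VT" "y \<in> VT" "proper_tree c ET"
    using three_proper'[OF x(1,2) y(1)] by blast
  \<comment> \<open>\<open>e\<close> is whichever of \<open>g\<close> and \<open>h\<close> the tree
    omits; every clash away from \<open>e\<close> would lie inside the tree.\<close>
  obtain e z where e: "e = {v, z}" "e \<in> C" "e \<notin> ET" "z \<in> VT"
    using clash_not_in_proper[OF assms T(5)] both[OF assms] x(3) y(2) T(3,4) by blast
  have "u \<in> e" if uc: "clash u p q" for u p q
  proof (rule ccontr)
    assume "u \<notin> e"
    then have "p \<noteq> e" "q \<noteq> e" using uc by (auto simp: clash_def)
    then have "p \<in> ET" "q \<in> ET"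
      using subtree_contains_rest_of_cycle[OF T(1)] e T(2) both[OF uc] by blast+
    then show False using clash_not_in_proper[OF uc T(5)] by blast
  qed
  then show ?thesis using e(2) by blast
qed

text \<open>With two edges more than colours at \<open>v\<close>, a clash survives the removal of
  either cycle edge there. So each of the two cycle edges clashes with a bridge, and a proper tree
  containing these bridges would omit both cycle edges.\<close>

lemma degree_le_colours:
  assumes "v \<in> V"
  shows "degree E v \<le> Suc (card (c ` E))"
proof (rule ccontr)
  assume "\<not> ?thesis"
  then have big: "Suc (card (c ` E)) < card {e \<in> E. v \<in> e}" by (simp add: degree_def)
  have clash_avoiding: "\<exists>p q. clash v p q \<and> p \<noteq> e \<and> q \<noteq> e" for e
  proof -
    have "card (c ` E) < card ({e \<in> E. v \<in> e} - {e})"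
      using big finite_E by (cases "e \<in> {e \<in> E. v \<in> e}") simp_all
    then show ?thesis using clash_pigeonhole[of "{e \<in> E. v \<in> e} - {e}" v] by blast
  qed
  obtain p q where "clash v p q" using clash_avoiding by blast
  then have "v \<in> \<Union>C" using clash_meets_cycle[of v p q] by (auto simp: clash_def)
  then have "card {f \<in> C. v \<in> f} = 2" using degree_cycle by (simp add: degree_def)
  then obtain h1 h2 where h: "{f \<in> C. v \<in> f} = {h1, h2}" "h1 \<noteq> h2" by (meson card_2_iff)
  have bridge_clash: "\<exists>g. clash v g h \<and> g \<notin> C"
    if h: "{f \<in> C. v \<in> f} = {h', h}" for h h'
  proof -
    obtain p q where pq: "clash v p q" "p \<noteq> h'" "q \<noteq> h'" using clash_avoiding by blast
    then have "p \<in> C \<longrightarrow> p = h" "q \<in> C \<longrightarrow> q = h" using h by (auto simp: clash_def)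
    moreover have "p \<noteq> q" using pq by (auto simp: clash_def)
    \<comment> \<open>Without \<open>h'\<close>, the only cycle edge left at \<open>v\<close> is
      \<open>h\<close>, so one edge of the clash is \<open>h\<close> and the other is a
      bridge.\<close>
    ultimately show ?thesis using clash_meets_cycle[OF pq(1)] clash_sym pq(1) by metis
  qed
  obtain g where g: "clash v g h2" "g \<notin> C" using bridge_clash h(1) by blast
  obtain g' where g': "clash v g' h1" "g' \<notin> C" using bridge_clash h(1) by (metis insert_commute)
  have hC: "h1 \<in> C" "h2 \<in> C" using h(1) by blast+
  have gE: "g \<in> E" "v \<in> g" "g' \<in> E" "v \<in> g'" "h1 \<in> E" "v \<in> h1"
    using g g' by (auto simp: clash_def)
  obtain w where w: "w \<in> V" "g = {v, w}" using gE by (elim edge_at[of g v]) auto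
  obtain w' where w': "w' \<in> V" "g' = {v, w'}" using gE by (elim edge_at[of g' v]) auto
  obtain x where x: "x \<in> V" "h1 = {v, x}" using gE by (elim edge_at[of h1 v]) auto
  \<comment> \<open>\<open>w\<close> and \<open>w'\<close> force in the bridges \<open>g\<close> and
    \<open>g'\<close>. With \<open>x\<close>, both ends of \<open>h1\<close> are in the tree, so
    omitting \<open>h1\<close> would force \<open>h2\<close> in.\<close>
  obtain VT ET where T: "is_subtree V E VT ET" "w \<in> VT" "w' \<in> VT" "x \<in> VT" "proper_tree c ET"
    using three_proper'[OF w(1) w'(1) x(1)] by blast
  have r: "(x, v) \<in> (adj_rel (E - {f}))\<^sup>*" if "f \<notin> C" for f
  proof (rule adj_rel_edge)
    have "{x, v} = h1" using x by auto
    then show "{x, v} \<in> E - {f}" using gE(5) hC that by auto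
  qed
  have "g \<in> ET" using subtree_contains_bridge[OF T(1) _ _ T(2,4)] r w(2) g(2) gE(1) by blast
  moreover have "g' \<in> ET"
    using subtree_contains_bridge[OF T(1) _ _ T(3,4)] r w'(2) g'(2) gE(3) by blast
  ultimately have "h1 \<notin> ET" "h2 \<notin> ET" "v \<in> VT"
    using clash_not_in_proper[OF _ T(5)] g g' T(1) gE(2) by (auto simp: is_subtree_def)
  then show False
    using subtree_contains_rest_of_cycle[OF T(1)] x(2) hC h(2) T(4) by metis
qed

end

section \<open>The two bounds combined\<close>

theorem mainTheorem13:
  fixes V :: "'a set" and E :: "'a set set" and k :: nat
  assumes "simple_graph V E"
    and "unicyclic V E"
    and "card V \<ge> 3"
    and "3 \<le> k" and "k \<le> card V"
  shows "proper_index V E k =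
    (if card {v \<in> V. degree E v = max_degree V E} \<le> 2
        \<and> (\<forall>v\<in>V. degree E v = max_degree V E \<longrightarrow> (\<forall>C. is_cycle_in E C \<longrightarrow> v \<in> \<Union>C))
        \<and> (\<forall>u\<in>V. \<forall>v\<in>V. degree E u = max_degree V E \<and> degree E v = max_degree V E \<and> u \<noteq> v
              \<longrightarrow> {u, v} \<in> E)
     then max_degree V E - 1 else max_degree V E)"
    (is "_ = (if ?cond then _ else _)")
proof -
  obtain C where C: "is_cycle_in E C" "\<And>C'. is_cycle_in E C' \<Longrightarrow> C' = C"
    using assms(2) unfolding unicyclic_def by blast
  interpret unicyclic_graph V E C
  proof
    show "connected_graph V E" using assms(2) by (simp add: unicyclic_def)
  qed (fact assms(1) C)+
  let ?D = "max_degree V E"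
  define M where "M = {v \<in> V. degree E v = ?D}"
  have le: "degree E v \<le> ?D" if "v \<in> V" for v
    unfolding max_degree_def using finite_V that by (intro Max_ge) auto
  have "?D \<in> degree E ` V" unfolding max_degree_def
    using finite_V conn by (intro Max_in) (auto simp: connected_graph_def)
  then obtain m where m: "m \<in> M" unfolding M_def by force
  have cond: "?cond \<longleftrightarrow> (\<exists>e\<in>C. M \<subseteq> e)"
  proof
    assume c: ?cond
    then have MC: "M \<subseteq> \<Union>C" using C(1) unfolding M_def by blast
    show "\<exists>e\<in>C. M \<subseteq> e"
    \<comment> \<open>For a single vertex any cycle edge at it will do; for two, the edge joining
      them lies on \<open>C\<close>.\<close>
    proof (cases "M = {m}")
      case True
      then show ?thesis using MC by blast
    next
      case False
      then obtain m' where m': "m' \<in> M" "m' \<noteq> m" using m by blast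
      have "{m, m'} \<subseteq> M" "finite M" using m m' finite_V by (auto simp: M_def)
      moreover have "card M \<le> card {m, m'}" using c m' by (simp add: M_def)
      ultimately have "{m, m'} = M" using card_seteq by blast
      moreover have "{m, m'} \<in> E" using c m m' unfolding M_def by blast
      ultimately show ?thesis using chord_in_cycle[of m m'] MC by blast
    qed
  next
    assume "\<exists>e\<in>C. M \<subseteq> e"
    then obtain e where e: "e \<in> C" "M \<subseteq> e" by blast
    then have "e \<in> E" using cycle_subset by blast
    then obtain p q where pq: "p \<noteq> q" "e = {p, q}" by (elim edgeE)
    have "card M \<le> card e" using e(2) pq by (intro card_mono) auto
    then have "card M \<le> 2" using pq by simp
    moreover have "\<forall>v\<in>M. \<forall>C'. is_cycle_in E C' \<longrightarrow> v \<in> \<Union>C'" using C(2) e by blast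
    moreover have "{u, v} \<in> E" if "u \<in> M" "v \<in> M" "u \<noteq> v" for u v
    proof -
      have "{u, v} = e" using that e(2) pq by auto
      then show ?thesis using \<open>e \<in> E\<close> by simp
    qed
    ultimately show ?cond unfolding M_def by blast
  qed
  have lower: "?D \<le> Suc (card (c ` E)) \<and> (\<not> ?cond \<longrightarrow> ?D \<le> card (c ` E))"
    if c: "k_proper_coloring V E k c" for c
  proof -
    interpret unicyclic_three_proper V E C c
    proof
      fix S assume S: "S \<subseteq> V" "card S \<le> 3"
      \<comment> \<open>Smaller sets are enlarged to size \<open>k\<close>, which
        \<open>3 \<le> k \<le> card V\<close> permits.\<close>
      then obtain S' where S': "S \<subseteq> S'" "S' \<subseteq> V" "card S' = k"
        using exists_subset_between[of S k V] assms(4,5) finite_V by auto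
      then obtain VT ET where "is_subtree V E VT ET" "S' \<subseteq> VT" "proper_tree c ET"
        using c unfolding k_proper_coloring_def by blast
      then show "\<exists>VT ET. is_subtree V E VT ET \<and> S \<subseteq> VT \<and> proper_tree c ET"
        using S'(1) by blast
    qed
    have "?cond" if "card (c ` E) < ?D"
    proof -
      have cl: "\<exists>g h. clash v g h" if "v \<in> M" for v
        using clash_pigeonhole[of "{e \<in> E. v \<in> e}" v] \<open>card (c ` E) < ?D\<close> that
        by (auto simp: M_def degree_def)
      then obtain e where e: "e \<in> C" "\<And>u g h. clash u g h \<Longrightarrow> u \<in> e"
        using cycle_edge_covers_clashes m by metis
      have "M \<subseteq> e" using cl e(2) by (meson subsetI)
      then have "\<exists>e\<in>C. M \<subseteq> e" using e(1) by (rule rev_bexI[rotated])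
      then show ?thesis unfolding cond .
    qed
    moreover have "?D \<le> Suc (card (c ` E))" using degree_le_colours[of m] m by (simp add: M_def)
    ultimately show ?thesis by linarith
  qed
  let ?R = "if ?cond then ?D - 1 else ?D"
  obtain e0 where "e0 \<in> C" using C(1) by (auto simp: is_cycle_in_def)
  \<comment> \<open>If the conditions fail, any cycle edge can be deleted, since the target is then
    \<open>?D\<close> itself.\<close>
  then obtain e where e: "e \<in> C" "?cond \<longrightarrow> M \<subseteq> e"
    unfolding cond by blast
  have "\<exists>c. k_proper_coloring V E k c \<and> card (c ` E) \<le> ?R"
  proof (rule coloring_from_spanning_tree[OF e(1)])
    fix v
    have eE: "e \<in> E" using e(1) cycle_subset by blast
    have E: "insert e (E - {e}) = E" using eE by auto
    have d: "degree E v = degree (E - {e}) v + (if v \<in> e then 1 else 0)"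
      using degree_insert[of "E - {e}" e v] finite_E unfolding E by simp
    show "degree (E - {e}) v \<le> ?R"
    proof (cases "v \<in> V")
      case True
      \<comment> \<open>Under the conditions, a vertex on \<open>e\<close> loses one edge and a
        vertex off \<open>e\<close> is below \<open>?D\<close> already, so both are at most
        \<open>?D - 1\<close>.\<close>
      have "v \<notin> e \<Longrightarrow> ?cond \<Longrightarrow> degree E v \<noteq> ?D" using e(2) True unfolding M_def by blast
      then show ?thesis using d le[OF True] by (cases "v \<in> e"; cases ?cond) auto
    next
      case False
      \<comment> \<open>The degree bound is required at every point of the type; outside
        \<open>V\<close> the degree is 0.\<close>
      then have "degree E v = 0" by (intro degree_eq_0) (auto elim: edgeE)
      then show ?thesis using d by simp
    qed
  qed
  then obtain c where c: "k_proper_coloring V E k c" "card (c ` E) \<le> ?R" by blast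
  have ge: "?R \<le> card (c' ` E)" if "k_proper_coloring V E k c'" for c'
    using lower[OF that] by auto
  show ?thesis
    unfolding proper_index_def
  proof (rule Least_equality)
    show "\<exists>c. k_proper_coloring V E k c \<and> card (c ` E) = ?R"
      using c ge[OF c(1)] by (intro exI[of _ c]) linarith
  qed (use ge in blast)
qed

end
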